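(* Let $m_0,m_1,\dots,m_N$ be regular moment functions of respective orders $s_0>0$ and $s_1,\dots,s_N\ge 1$. Then the Cauchy problem $$\begin{cases}\partial_{m_0;t}^{\kappa}u-\displaystyle\sum_{n\in\mathcal I}\sum_{(\underline i,\underline q,\underline r)\in\Lambda_n}t^{v_{\underline i,\underline q,\underline r}}a_{\underline i,\underline q,\underline r}(t,x)\prod_{\ell=1}^n\left(\partial_{m_0;t}^{i_\ell}\partial_{m;x}^{q_\ell}u\right)^{r_\ell}=\widetilde f(t,x)\\ \partial_{m_0;t}^{j}u(t,x)_{|t=0}=\varphi_j(x),\quad 0\le j<\kappa\end{cases}$$ with data as specified in the context, is formally well-posed; that is, it has a unique formal power series solution $\widetilde u(t,x)\in\mathcal O(D_{\rho_1,\dots,\rho_N})[[t]]$.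
   Context: Notation. $\mathbb N=\{0,1,2,\dots\}$, $\mathbb N^*=\mathbb N\setminus\{0\}$. $D_\rho=\{z\in\mathbb C:|z|<\rho\}$, $D_{\rho_0,\dots,\rho_N}=D_{\rho_0}\times\dots\times D_{\rho_N}$, $D_{\rho_1,\dots,\rho_N}=D_{\rho_1}\times\dots\times D_{\rho_N}$. $\mathcal O(U)$ is the set of holomorphic functions on $U$, and $\mathcal O(U)[[t]]$ the set of formal power series in $t$ with coefficients in $\mathcal O(U)$. $S_d(\alpha)=\{x\in\mathbb C:x\ne0,\ |\arg x-d|<\alpha/2\}$. Moment functions. Let $0<s<2$ and $k=1/s$. Kernel functions of order $s$ are pairs $(e,E)$ such that: (1) $e$ is holomorphic on $S_0(\pi s)$, $e(t)>0$ for $t>0$, $t^{-1}e(t)$ is integrable at zero, and for every $\varepsilon>0$ there are $A,B>0$ with $|e(x)|\le A\exp(-(|x|/B)^k)$ on $S_0(\pi s-\varepsilon)$; (2) $E$ is entire with global exponential growth of order at most $k$ at infinity, and $t^{-1}E(1/t)$ is integrable at zero in $S_\pi(\pi(2-s))$; (3) with $m(\lambda)=\int_0^{+\infty}t^{\lambda-1}e(t)\,dt$ for $\mathrm{Re}(\lambda)\ge0$, one has $E(t)=\sum_{j\ge0}t^j/m(j)$ for all $t\in\mathbb C$. The function $m$ is called a moment function of order $s$. For general $s>0$, choose an integer $p\ge1$ with $s/p<2$; a kernel function of order $s$ is $e(t)=\hat e(t^{1/p})/p$, where $\hat e$ is the first member of a pair $(\hat e,\hat E)$ satisfying conditions (1),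 (2), (3) with $s$ replaced by $s/p$ and $k$ replaced by $p/s$, and the corresponding moment function of order $s$ is $m(\lambda)=\int_0^{+\infty}t^{\lambda-1}e(t)\,dt$. It is always assumed that $m(0)=1$. A moment function $m$ of order $s>0$ is regular if there are $a,A>0$ with $a(j+1)^s\le m(j+1)/m(j)\le A(j+1)^s$ for all $j\in\mathbb N$. Moment derivatives. For $\widetilde u=\sum_{j\ge0}u_{j,*}(x)\frac{t^j}{m_0(j)}$, $\partial_{m_0;t}\widetilde u=\sum_{j\ge0}u_{j+1,*}(x)\frac{t^j}{m_0(j)}$. The operator $\partial_{m_d;x_d}$ is defined in the same way on power series in $x_d$ (with $m_d$), acting on analytic functions via their Taylor expansion at $0$ and coefficientwise on formal series in $t$. For $q=(q_1,\dots,q_N)\in\mathbb N^N$, $\partial_{m;x}^q=\partial_{m_1;x_1}^{q_1}\cdots\partial_{m_N;x_N}^{q_N}$. Data of the equation. $\kappa\ge1$ is an integer; $\mathcal I$ is a non-empty finite subset of $\mathbb N^*$; for $n\in\mathcal I$, $\Lambda_n$ is a non-empty finite set of $n$-tuples $(\underline i,\underline q,\underline r)=((i_1,q_1,r_1),\dots,(i_n,q_n,r_n))$ of elements of $\{0,\dots,\kappa-1\}\times\mathbb N^N\times\mathbb N^*$ whose pairs $(i_k,q_k)$ are pairwise distinct; $v_{\underline i,\underline q,\underline r}\in\mathbb N$; $a_{\underline i,\underline q,\underline r}\in\mathcal O(D_{\rho_0,\rho_1,\dots,\rho_N})$ with $a_{\underline i,\underline q,\underline r}(0,x)\not\equiv0$;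 $\widetilde f\in\mathcal O(D_{\rho_1,\dots,\rho_N})[[t]]$; $\varphi_j\in\mathcal O(D_{\rho_1,\dots,\rho_N})$. *)

theory Defs
  imports "HOL-Complex_Analysis.Complex_Analysis" "HOL-Library.Function_Algebras"
begin

definition polydisc :: "('i::finite \<Rightarrow> real) \<Rightarrow> (complex ^ 'i) set" where
  "polydisc \<rho> = {z. \<forall>d. norm (z $ d) < \<rho> d}"

text \<open>Complex differentiability, i.e. existence of a complex-linear Frechet derivative at each
  point. It is only used for open \<open>U\<close>.\<close>

definition holomorphic_several :: "(complex ^ 'i::finite \<Rightarrow> complex) \<Rightarrow> (complex ^ 'i) set \<Rightarrow> bool" where
  "holomorphic_several f U \<longleftrightarrow>
     (\<forall>z\<in>U. \<exists>f'. (f has_derivative f') (at z) \<and> (\<forall>c h. f' (c *s h) = c * f' h))"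

text \<open>The set \<open>\<O>(U)\<close>. A function on \<open>U\<close> is represented by its extension by \<open>0\<close>, so that
  equality of elements of \<open>\<O>(U)\<close> is equality of functions on \<open>U\<close>.\<close>

definition hol :: "(complex ^ 'i::finite) set \<Rightarrow> (complex ^ 'i \<Rightarrow> complex) set" where
  "hol U = {f. holomorphic_several f U \<and> (\<forall>z. z \<notin> U \<longrightarrow> f z = 0)}"

text \<open>The set \<open>\<O>(U)[[t]]\<close>. Functions carry the pointwise ring structure, hence the product of
  the type \<open>fps\<close> is the Cauchy product with pointwise products of coefficients.\<close>

definition hol_fps :: "(complex ^ 'i::finite) set \<Rightarrow> (complex ^ 'i \<Rightarrow> complex) fps set" where
  "hol_fps U = {u. \<forall>j. fps_nth u j \<in> hol U}"

text \<open>The variables \<open>(t, x)\<close> are indexed by \<open>'n option\<close>, with \<open>None\<close> for \<open>t\<close>.\<close>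

definition tx :: "complex \<Rightarrow> complex ^ 'n::finite \<Rightarrow> complex ^ 'n option" where
  "tx t x = (\<chi> d. case d of None \<Rightarrow> t | Some d' \<Rightarrow> x $ d')"

text \<open>An analytic function \<open>a(t, x)\<close> as the formal power series in \<open>t\<close> given by its Taylor
  expansion at \<open>t = 0\<close>.\<close>

definition taylor_t :: "(complex ^ 'n option \<Rightarrow> complex) \<Rightarrow> (complex ^ 'n::finite \<Rightarrow> complex) fps" where
  "taylor_t a = Abs_fps (\<lambda>j x. fps_nth (fps_expansion (\<lambda>t. a (tx t x)) 0) j)"

text \<open>For openings \<open>\<alpha> \<le> 2 * pi\<close> this is the sector in \<open>\<complex>\<close> of all nonzero \<open>x\<close> having
  some argument \<open>\<theta>\<close> with \<open>\<bar>\<theta> - d\<bar> < \<alpha> / 2\<close>.\<close>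

definition sector :: "real \<Rightarrow> real \<Rightarrow> complex set" where
  "sector d \<alpha> = {rcis r \<theta> | r \<theta>. r > 0 \<and> \<bar>\<theta> - d\<bar> < \<alpha> / 2}"

definition moment_of :: "(real \<Rightarrow> complex) \<Rightarrow> complex \<Rightarrow> complex" where
  "moment_of e z = set_lebesgue_integral lborel {0<..} (\<lambda>t. of_real t powr (z - 1) * e t)"

text \<open>Integrability at zero means absolute integrability near zero on the positive half-line for
  \<open>e(t) / t\<close>, and along every ray of the sector for \<open>E(1 / t) / t\<close>.\<close>

definition kernel_pair :: "real \<Rightarrow> (complex \<Rightarrow> complex) \<Rightarrow> (complex \<Rightarrow> complex) \<Rightarrow> bool" where
  "kernel_pair s e E \<longleftrightarrow>
     0 < s \<and> s < 2 \<and>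
     e holomorphic_on sector 0 (pi * s) \<and>
     (\<forall>t::real. t > 0 \<longrightarrow> e (of_real t) \<in> \<real> \<and> Re (e (of_real t)) > 0) \<and>
     (\<exists>\<delta>>0. set_integrable lborel {0<..\<delta>} (\<lambda>t::real. e (of_real t) / of_real t)) \<and>
     (\<forall>\<epsilon>>0. \<exists>A>0. \<exists>B>0. \<forall>x \<in> sector 0 (pi * s - \<epsilon>).
        norm (e x) \<le> A * exp (- ((norm x / B) powr (1 / s)))) \<and>
     E holomorphic_on UNIV \<and>
     (\<exists>A>0. \<exists>B>0. \<forall>x. norm (E x) \<le> A * exp ((norm x / B) powr (1 / s))) \<and>
     (\<forall>\<theta>. \<bar>\<theta> - pi\<bar> < pi * (2 - s) / 2 \<longrightarrow>
        (\<exists>\<delta>>0. set_integrable lborel {0<..\<delta>} (\<lambda>r. E (1 / rcis r \<theta>) / rcis r \<theta>))) \<and>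
     (\<forall>t. (\<lambda>j. t ^ j / moment_of (\<lambda>r. e (of_real r)) (of_nat j)) sums E t)"

text \<open>For \<open>p = 1\<close> this is the definition for orders \<open>s < 2\<close>; the normalization \<open>m 0 = 1\<close> is
  included. Only the values of \<open>m\<close> on the half-plane \<open>Re z \<ge> 0\<close> are specified.\<close>

definition moment_function :: "real \<Rightarrow> (complex \<Rightarrow> complex) \<Rightarrow> bool" where
  "moment_function s m \<longleftrightarrow>
     (\<exists>p::nat. p \<ge> 1 \<and> s / real p < 2 \<and>
       (\<exists>e E. kernel_pair (s / real p) e E \<and>
          (\<forall>z. Re z \<ge> 0 \<longrightarrow>
             m z = moment_of (\<lambda>t. e (of_real (t powr (1 / real p))) / of_nat p) z))) \<and>
     m 0 = 1"

text \<open>The numbers \<open>m j\<close> are positive reals, so \<open>Re\<close> is only a coercion here.\<close>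

definition regular_moment_function :: "real \<Rightarrow> (complex \<Rightarrow> complex) \<Rightarrow> bool" where
  "regular_moment_function s m \<longleftrightarrow>
     moment_function s m \<and>
     (\<exists>a>0. \<exists>A>0. \<forall>j::nat.
        a * (real j + 1) powr s \<le> Re (m (of_nat (j + 1)) / m (of_nat j)) \<and>
        Re (m (of_nat (j + 1)) / m (of_nat j)) \<le> A * (real j + 1) powr s)"

text \<open>If the coefficient of index \<open>j\<close> of \<open>F\<close> is \<open>u j / m j\<close>, then that of the moment
  derivative is \<open>u (j + 1) / m j\<close>.\<close>

definition moment_deriv :: "(complex \<Rightarrow> complex) \<Rightarrow> complex fps \<Rightarrow> complex fps" where
  "moment_deriv m F = Abs_fps (\<lambda>j. m (of_nat (j + 1)) * fps_nth F (j + 1) / m (of_nat j))"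

definition moment_deriv_t ::
    "(complex \<Rightarrow> complex) \<Rightarrow> ('a \<Rightarrow> complex) fps \<Rightarrow> ('a \<Rightarrow> complex) fps" where
  "moment_deriv_t m u =
     Abs_fps (\<lambda>j x. fps_nth (moment_deriv m (Abs_fps (\<lambda>i. fps_nth u i x))) j)"

text \<open>On \<open>f \<in> \<O>(U)\<close> the operator in the variable \<open>x\<^sub>d\<close> acts on the Taylor expansion of \<open>f\<close> at
  \<open>x\<^sub>d = 0\<close>, whose coefficients depend on the other variables.\<close>

definition moment_deriv_x ::
    "(complex ^ 'n::finite) set \<Rightarrow> (complex \<Rightarrow> complex) \<Rightarrow> 'n \<Rightarrow>
     (complex ^ 'n \<Rightarrow> complex) \<Rightarrow> (complex ^ 'n \<Rightarrow> complex)" where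
  "moment_deriv_x U m d f = (\<lambda>x. if x \<in> U
     then eval_fps (moment_deriv m
            (fps_expansion (\<lambda>z. f (\<chi> i. if i = d then z else x $ i)) 0)) (x $ d)
     else 0)"

text \<open>The composition \<open>\<partial>\<^sub>1\<^bsup>q 1\<^esup> \<circ> \<dots> \<circ> \<partial>\<^sub>N\<^bsup>q N\<^esup>\<close>; the linear order on the index type \<open>'n\<close> plays the
  role of the numbering of the variables.\<close>

definition moment_deriv_multi ::
    "(complex ^ 'n::{finite,linorder}) set \<Rightarrow> ('n \<Rightarrow> complex \<Rightarrow> complex) \<Rightarrow> nat ^ 'n::_ \<Rightarrow>
     (complex ^ 'n::_ \<Rightarrow> complex) \<Rightarrow> (complex ^ 'n::_ \<Rightarrow> complex)" where
  "moment_deriv_multi U m q =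
     foldr (\<circ>) (map (\<lambda>d. moment_deriv_x U (m d) d ^^ (q $ d)) (sorted_list_of_set UNIV)) id"

definition moment_deriv_multi_fps ::
    "(complex ^ 'n::{finite,linorder}) set \<Rightarrow> ('n \<Rightarrow> complex \<Rightarrow> complex) \<Rightarrow> nat ^ 'n::_ \<Rightarrow>
     (complex ^ 'n::_ \<Rightarrow> complex) fps \<Rightarrow> (complex ^ 'n::_ \<Rightarrow> complex) fps" where
  "moment_deriv_multi_fps U m q u = Abs_fps (\<lambda>j. moment_deriv_multi U m q (fps_nth u j))"

text \<open>A tuple \<open>((i\<^sub>1, q\<^sub>1, r\<^sub>1), \<dots>, (i\<^sub>n, q\<^sub>n, r\<^sub>n))\<close> is the list of its entries. It determines
  \<open>n\<close>, so the families \<open>v\<close> and \<open>a\<close> are indexed by the tuple alone.\<close>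

type_synonym 'n multi_index = "(nat \<times> (nat ^ 'n) \<times> nat) list"

definition admissible :: "nat \<Rightarrow> nat \<Rightarrow> 'n::finite multi_index \<Rightarrow> bool" where
  "admissible \<kappa> n T \<longleftrightarrow>
     length T = n \<and> (\<forall>(i, q, r) \<in> set T. i < \<kappa> \<and> r \<ge> 1) \<and> distinct (map (\<lambda>(i, q, r). (i, q)) T)"

definition formal_solution ::
    "(complex ^ 'n::{finite,linorder}) set \<Rightarrow> (complex \<Rightarrow> complex) \<Rightarrow> ('n \<Rightarrow> complex \<Rightarrow> complex) \<Rightarrow>
     nat \<Rightarrow> nat set \<Rightarrow> (nat \<Rightarrow> 'n multi_index set) \<Rightarrow> ('n multi_index \<Rightarrow> nat) \<Rightarrow>
     ('n multi_index \<Rightarrow> complex ^ 'n option \<Rightarrow> complex) \<Rightarrow>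
     (complex ^ 'n::_ \<Rightarrow> complex) fps \<Rightarrow> (nat \<Rightarrow> complex ^ 'n::_ \<Rightarrow> complex) \<Rightarrow>
     (complex ^ 'n::_ \<Rightarrow> complex) fps \<Rightarrow> bool" where
  "formal_solution U m\<^sub>0 m \<kappa> I \<Lambda> v a f \<phi> u \<longleftrightarrow>
     u \<in> hol_fps U \<and>
     (moment_deriv_t m\<^sub>0 ^^ \<kappa>) u
       - (\<Sum>n\<in>I. \<Sum>T\<in>\<Lambda> n. fps_X ^ v T * taylor_t (a T) *
            (\<Prod>l<n. case T ! l of (i, q, r) \<Rightarrow>
               ((moment_deriv_t m\<^sub>0 ^^ i) (moment_deriv_multi_fps U m q u)) ^ r))
       = f \<and>
     (\<forall>j<\<kappa>. fps_nth ((moment_deriv_t m\<^sub>0 ^^ j) u) 0 = \<phi> j)"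

end

theory Submission
  imports Defs "HOL-Real_Asymp.Real_Asymp"
begin

text \<open>Comparing the coefficients of \<open>t ^ k\<close> on both sides turns the Cauchy problem into a recursion.
  By \<open>fps_nth_moment_deriv_t_power\<close>, the coefficient of \<open>t ^ k\<close> in the \<open>\<kappa>\<close>-th moment derivative of
  \<open>u\<close> is the nonzero number \<open>m\<^sub>0 (k + \<kappa>) / m\<^sub>0 k\<close> times \<open>u\<^sub>k\<^sub>+\<^sub>\<kappa>\<close>. Every derivative in
  the nonlinear terms has order \<open>i < \<kappa>\<close> in \<open>t\<close>, and multiplying power series never moves
  information from higher to lower coefficients; so the coefficient
  of \<open>t ^ k\<close> of the nonlinear part involves only \<open>u\<^sub>j\<close> with \<open>j < k + \<kappa>\<close>
  (\<open>nonlinear_part_causal\<close>). The initial conditions fix \<open>u\<^sub>0, \<dots>, u\<^sub>\<kappa>\<^sub>-\<^sub>1\<close>, and the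
  equation then determines all further coefficients one after the other
  (\<open>formal_solution_iff_recursion\<close>, \<open>strictly_causal_fixpoint\<close>).

  What remains is analysis: the recursion must not leave the holomorphic functions on the polydisc.
  Two operations are not obviously harmless. Passing from \<open>a(t, x)\<close> to its Taylor coefficients in
  \<open>t\<close> is repeated partial differentiation, and the moment derivative in \<open>x\<^sub>d\<close> is the sum of the
  series with terms \<open>m (j + 1) / m j * c\<^sub>j\<^sub>+\<^sub>1(x) * x\<^sub>d ^ j\<close>, where the \<open>c\<^sub>j\<close> are the Taylor
  coefficients in \<open>x\<^sub>d\<close>. Regularity of \<open>m\<close> makes the first factor grow at most polynomially, so the
  series converges locally uniformly on the whole polydisc. Both cases thus rest on one fact,
  \<open>holomorphic_several_uniform_limit_ball\<close>: complex differentiability in several variables survives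
  uniform limits. It follows from the Cauchy inequality on complex lines, which bounds the
  derivative of a function by the function.\<close>

(* The infix dollar sign denotes vector components throughout. *)
no_notation fps_nth (infixl \<open>$\<close> 75)

section \<open>Holomorphic functions of several variables\<close>

abbreviation complex_homogeneous :: "(complex ^ 'i::finite \<Rightarrow> complex) \<Rightarrow> bool" where
  "complex_homogeneous L \<equiv> \<forall>c h. L (c *s h) = c * L h"

definition coord_upd :: "complex ^ 'i::finite \<Rightarrow> 'i \<Rightarrow> complex \<Rightarrow> complex ^ 'i" where
  "coord_upd x d z = (\<chi> i. if i = d then z else x $ i)"

lemma coord_upd_nth: "coord_upd x d z $ i = (if i = d then z else x $ i)"
  by (simp add: coord_upd_def)

lemma coord_upd_upd [simp]: "coord_upd (coord_upd x d z) d w = coord_upd x d w"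
  by (simp add: coord_upd_def vec_eq_iff)

lemma coord_upd_triv [simp]: "coord_upd x d (x $ d) = x"
  by (simp add: coord_upd_def vec_eq_iff)

lemma coord_upd_line: "coord_upd x d z = (x - (x $ d) *s axis d 1) + z *s axis d 1"
  by (simp add: coord_upd_def vec_eq_iff axis_def)

lemma norm_scalar_mult_vec: "norm (c *s (x :: complex ^ 'i::finite)) = norm c * norm x"
  by (simp add: norm_vec_def norm_mult L2_set_right_distrib)

lemma bounded_linear_scalar_mult_vec: "bounded_linear (\<lambda>c. c *s (h :: complex ^ 'i::finite))"
  by (rule bounded_linear_intro[where K = "norm h"])
     (auto simp: vec_eq_iff algebra_simps norm_scalar_mult_vec)

lemma holomorphic_severalD:
  assumes "holomorphic_several f U" "z \<in> U"
  obtains L where "(f has_derivative L) (at z)" "complex_homogeneous L"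
  using assms unfolding holomorphic_several_def by blast

lemma holomorphic_several_subset:
  "holomorphic_several f U \<Longrightarrow> V \<subseteq> U \<Longrightarrow> holomorphic_several f V"
  unfolding holomorphic_several_def by blast

lemma holomorphic_several_transform:
  assumes "holomorphic_several f U" "open U" "\<And>z. z \<in> U \<Longrightarrow> g z = f z"
  shows "holomorphic_several g U"
  unfolding holomorphic_several_def
proof
  fix z assume z: "z \<in> U"
  with assms(1) obtain L where L: "(f has_derivative L) (at z)" "complex_homogeneous L"
    by (rule holomorphic_severalD)
  have "(g has_derivative L) (at z)"
    by (rule has_derivative_transform_within_open[OF L(1) assms(2) z]) (simp add: assms(3))
  with L show "\<exists>L. (g has_derivative L) (at z) \<and> complex_homogeneous L" by blast
qed

lemma holomorphic_several_local:
  assumes "\<And>z. z \<in> U \<Longrightarrow> \<exists>r>0. holomorphic_several f (ball z r)"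
  shows "holomorphic_several f U"
  using assms unfolding holomorphic_several_def by (metis centre_in_ball)

lemma holomorphic_several_continuous_on:
  "holomorphic_several f U \<Longrightarrow> continuous_on U f"
  unfolding holomorphic_several_def
  by (meson continuous_at_imp_continuous_on has_derivative_continuous)

lemma holomorphic_several_const: "holomorphic_several (\<lambda>z. c) U"
  unfolding holomorphic_several_def by (auto intro!: exI[of _ "\<lambda>h. 0"] derivative_intros)

lemma holomorphic_several_coord: "holomorphic_several (\<lambda>z. z $ d) U"
  unfolding holomorphic_several_def
  by (auto intro!: exI[of _ "\<lambda>h. h $ d"] bounded_linear_imp_has_derivative bounded_linear_vec_nth)

lemma holomorphic_several_add:
  assumes "holomorphic_several f U" "holomorphic_several g U"
  shows "holomorphic_several (\<lambda>z. f z + g z) U"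
  unfolding holomorphic_several_def
proof
  fix z assume z: "z \<in> U"
  from assms(1) z obtain L where L: "(f has_derivative L) (at z)" "complex_homogeneous L"
    by (rule holomorphic_severalD)
  from assms(2) z obtain M where M: "(g has_derivative M) (at z)" "complex_homogeneous M"
    by (rule holomorphic_severalD)
  show "\<exists>L. ((\<lambda>z. f z + g z) has_derivative L) (at z) \<and> complex_homogeneous L"
    using L M by (intro exI[of _ "\<lambda>h. L h + M h"]) (auto intro!: derivative_intros simp: algebra_simps)
qed

lemma holomorphic_several_mult:
  assumes "holomorphic_several f U" "holomorphic_several g U"
  shows "holomorphic_several (\<lambda>z. f z * g z) U"
  unfolding holomorphic_several_def
proof
  fix z assume z: "z \<in> U"
  from assms(1) z obtain L where L: "(f has_derivative L) (at z)" "complex_homogeneous L"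
    by (rule holomorphic_severalD)
  from assms(2) z obtain M where M: "(g has_derivative M) (at z)" "complex_homogeneous M"
    by (rule holomorphic_severalD)
  show "\<exists>L. ((\<lambda>z. f z * g z) has_derivative L) (at z) \<and> complex_homogeneous L"
    using L M by (intro exI[of _ "\<lambda>h. f z * M h + L h * g z"] conjI has_derivative_mult)
      (auto simp: algebra_simps)
qed

lemma holomorphic_several_cmult:
  "holomorphic_several f U \<Longrightarrow> holomorphic_several (\<lambda>z. c * f z) U"
  by (intro holomorphic_several_mult holomorphic_several_const)

lemma holomorphic_several_diff:
  "holomorphic_several f U \<Longrightarrow> holomorphic_several g U \<Longrightarrow> holomorphic_several (\<lambda>z. f z - g z) U"
  using holomorphic_several_add[OF _ holomorphic_several_cmult[of g U "-1"]] by simp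

lemma holomorphic_several_power:
  "holomorphic_several f U \<Longrightarrow> holomorphic_several (\<lambda>z. f z ^ n) U"
  by (induction n) (auto intro: holomorphic_several_mult holomorphic_several_const)

lemma holomorphic_several_sum:
  "(\<And>i. i \<in> A \<Longrightarrow> holomorphic_several (f i) U) \<Longrightarrow> holomorphic_several (\<lambda>z. \<Sum>i\<in>A. f i z) U"
  by (induction A rule: infinite_finite_induct)
     (auto intro: holomorphic_several_add holomorphic_several_const)

lemma holomorphic_several_compose_affine:
  assumes f: "holomorphic_several f V" and g: "\<And>z. z \<in> U \<Longrightarrow> g z \<in> V"
    and L: "\<And>z. (g has_derivative L) (at z)" "\<And>c h. L (c *s h) = c *s L h"
  shows "holomorphic_several (\<lambda>z. f (g z)) U"
  unfolding holomorphic_several_def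
proof
  fix z assume z: "z \<in> U"
  from f g[OF z] obtain M where M: "(f has_derivative M) (at (g z))" "complex_homogeneous M"
    by (rule holomorphic_severalD)
  show "\<exists>K. ((\<lambda>z. f (g z)) has_derivative K) (at z) \<and> complex_homogeneous K"
    using M L by (intro exI[of _ "\<lambda>h. M (L h)"]) (auto intro: has_derivative_compose)
qed

lemma holomorphic_several_compose_translation:
  assumes "holomorphic_several f V" "\<And>z. z \<in> U \<Longrightarrow> z + a \<in> V"
  shows "holomorphic_several (\<lambda>z. f (z + a)) U"
  by (rule holomorphic_several_compose_affine[OF assms(1), of U "\<lambda>z. z + a" "\<lambda>h. h"])
     (use assms(2) in \<open>auto intro!: derivative_eq_intros\<close>)

lemma holomorphic_several_compose_coord_upd:
  assumes "holomorphic_several f V" "\<And>x. x \<in> U \<Longrightarrow> coord_upd x d w \<in> V"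
  shows "holomorphic_several (\<lambda>x. f (coord_upd x d w)) U"
proof (rule holomorphic_several_compose_affine[OF assms])
  show "((\<lambda>x. coord_upd x d w) has_derivative (\<lambda>h. coord_upd h d 0)) (at z)" for z
    unfolding coord_upd_line
    by (auto intro!: derivative_eq_intros bounded_linear_imp_has_derivative
        bounded_linear_compose[OF bounded_linear_scalar_mult_vec] bounded_linear_vec_nth)
  show "coord_upd (c *s h) d 0 = c *s coord_upd h d 0" for c h
    by (simp add: vec_eq_iff coord_upd_def)
qed

lemma holomorphic_several_compose_tx:
  assumes "holomorphic_several f V" "\<And>x. x \<in> U \<Longrightarrow> tx 0 x \<in> V"
  shows "holomorphic_several (\<lambda>x. f (tx 0 x)) U"
proof (rule holomorphic_several_compose_affine[OF assms])
  have "linear (tx 0 :: complex ^ 'a \<Rightarrow> _)"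
    by (auto intro!: linearI simp: tx_def vec_eq_iff split: option.splits)
  thus "(tx 0 has_derivative tx 0) (at z)" for z :: "complex ^ 'a"
    using linear_conv_bounded_linear bounded_linear_imp_has_derivative by blast
  show "tx 0 (c *s h) = c *s tx 0 h" for c and h :: "complex ^ 'a"
    by (auto simp: tx_def vec_eq_iff split: option.splits)
qed

text \<open>Restricting to complex lines reduces every estimate below to a function of one variable.\<close>

lemma has_field_derivative_along_line:
  assumes "(f has_derivative L) (at (x + c *s h))" "complex_homogeneous L"
  shows "((\<lambda>k. f (x + k *s h)) has_field_derivative L h) (at c)"
proof -
  have "((\<lambda>k. x + k *s h) has_derivative (\<lambda>k. k *s h)) (at c)"
    by (auto intro!: derivative_eq_intros bounded_linear_imp_has_derivative
        bounded_linear_scalar_mult_vec)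
  from has_derivative_compose[OF this assms(1)]
  have "((\<lambda>k. f (x + k *s h)) has_derivative (\<lambda>k. L (k *s h))) (at c)" .
  also have "(\<lambda>k. L (k *s h)) = (*) (L h)"
    using assms(2) by (auto simp: mult.commute)
  finally show ?thesis by (simp add: has_field_derivative_def)
qed

lemma holomorphic_on_line:
  assumes "holomorphic_several f U" "\<And>k. k \<in> A \<Longrightarrow> x + k *s h \<in> U"
  shows "(\<lambda>k. f (x + k *s h)) holomorphic_on A"
proof (rule holomorphic_onI)
  fix k assume "k \<in> A"
  with assms obtain L where "(f has_derivative L) (at (x + k *s h))" "complex_homogeneous L"
    by (meson holomorphic_severalD)
  from has_field_derivative_along_line[OF this]
  show "(\<lambda>k. f (x + k *s h)) field_differentiable at k within A"
    using field_differentiable_at_within field_differentiable_def by blast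
qed

text \<open>The derivative in direction \<open>h\<close> is the derivative of a function of one variable, the restriction
  to the line through \<open>x\<close> in direction \<open>h\<close>, on which the disc of radius \<open>r / norm h\<close> stays in
  the ball. So the one-variable Cauchy inequality bounds the operator norm.\<close>

lemma Cauchy_estimate_several:
  assumes f: "holomorphic_several f U" "cball x r \<subseteq> U" "r > 0"
    and L: "(f has_derivative L) (at x)" "complex_homogeneous L"
    and M: "\<And>z. z \<in> cball x r \<Longrightarrow> norm (f z) \<le> M"
  shows "norm (L h) \<le> M / r * norm h"
proof (cases "h = 0")
  case True
  thus ?thesis using L(2)[rule_format, of 0 0] by simp
next
  case False
  define R where "R = r / norm h"
  have R: "R > 0" using False f(3) by (simp add: R_def)
  have in_ball: "x + k *s h \<in> cball x r" if "k \<in> cball 0 R" for k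
    using that False by (simp add: dist_norm norm_scalar_mult_vec R_def field_simps)
  have hol: "(\<lambda>k. f (x + k *s h)) holomorphic_on cball 0 R"
    by (rule holomorphic_on_line[OF f(1)]) (use in_ball f(2) in blast)
  have "norm ((deriv ^^ 1) (\<lambda>k. f (x + k *s h)) 0) \<le> fact 1 * M / R ^ 1"
    by (rule Cauchy_inequality)
       (use R in \<open>auto intro: holomorphic_on_imp_continuous_on[OF hol]
          holomorphic_on_subset[OF hol] intro!: M in_ball\<close>)
  moreover have "deriv (\<lambda>k. f (x + k *s h)) 0 = L h"
    by (rule DERIV_imp_deriv, rule has_field_derivative_along_line) (use L in auto)
  ultimately show ?thesis by (simp add: R_def)
qed

text \<open>Applied to the differences \<open>f m - f n\<close>, the Cauchy estimate shows that the derivatives form a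
  Cauchy sequence uniformly in the operator norm, and then differentiation and limit can be
  interchanged. The radius shrinks by a factor of three, which leaves around every point of the
  small ball a closed ball of radius \<open>r\<close> for the estimate.\<close>

lemma holomorphic_several_uniform_limit_ball:
  assumes hol: "\<And>n. holomorphic_several (f n) (ball x (3 * r))" and r: "r > 0"
    and lim: "uniform_limit (ball x (3 * r)) f g sequentially"
  shows "holomorphic_several g (ball x r)"
proof -
  let ?S = "ball x r"
  have sub: "cball y r \<subseteq> ball x (3 * r)" if "y \<in> ?S" for y
  proof
    fix z assume "z \<in> cball y r"
    thus "z \<in> ball x (3 * r)" using that r dist_triangle[of x z y] by simp
  qed
  have inS: "y \<in> ball x (3 * r)" if "y \<in> ?S" for y
    using that r by simp
  define D where "D = (\<lambda>n y. frechet_derivative (f n) (at y))"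
  have D: "(f n has_derivative D n y) (at y)" "complex_homogeneous (D n y)" if "y \<in> ?S" for n y
  proof -
    from hol inS[OF that] obtain L where "(f n has_derivative L) (at y)" "complex_homogeneous L"
      by (rule holomorphic_severalD)
    moreover from this have "D n y = L"
      unfolding D_def by (metis frechet_derivative_at)
    ultimately show "(f n has_derivative D n y) (at y)" "complex_homogeneous (D n y)" by auto
  qed
  have uc: "\<exists>N. \<forall>m\<ge>N. \<forall>n\<ge>N. \<forall>y\<in>?S. \<forall>h. norm (D m y h - D n y h) \<le> e * norm h"
    if e: "e > 0" for e
  proof -
    have "e * r / 2 > 0" using e r by simp
    with lim have "\<forall>\<^sub>F n in sequentially. \<forall>z\<in>ball x (3 * r). dist (f n z) (g z) < e * r / 2"
      unfolding uniform_limit_iff by blast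
    then obtain N where N: "\<And>n z. n \<ge> N \<Longrightarrow> z \<in> ball x (3 * r) \<Longrightarrow> dist (f n z) (g z) < e * r / 2"
      unfolding eventually_sequentially by blast
    have "norm (D m y h - D n y h) \<le> e * norm h" if "m \<ge> N" "n \<ge> N" "y \<in> ?S" for m n y h
    proof -
      have "norm (D m y h - D n y h) \<le> (e * r) / r * norm h"
      proof (rule Cauchy_estimate_several[where f = "\<lambda>z. f m z - f n z" and U = "ball x (3 * r)"
               and x = y and L = "\<lambda>h. D m y h - D n y h"])
        show "norm (f m z - f n z) \<le> e * r" if "z \<in> cball y r" for z
        proof -
          have "z \<in> ball x (3 * r)" using sub[OF \<open>y \<in> ?S\<close>] that by blast
          from N[OF \<open>m \<ge> N\<close> this] N[OF \<open>n \<ge> N\<close> this]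
          have "dist (f m z) (f n z) < e * r"
            using dist_triangle2[of "f m z" "f n z" "g z"] by simp
          thus ?thesis by (simp add: dist_norm)
        qed
        show "holomorphic_several (\<lambda>z. f m z - f n z) (ball x (3 * r))"
          by (intro holomorphic_several_diff hol)
        show "((\<lambda>z. f m z - f n z) has_derivative (\<lambda>h. D m y h - D n y h)) (at y)"
          by (intro has_derivative_diff D \<open>y \<in> ?S\<close>)
        show "complex_homogeneous (\<lambda>h. D m y h - D n y h)"
          using D(2)[OF \<open>y \<in> ?S\<close>] by (simp add: algebra_simps)
      qed (use sub[OF \<open>y \<in> ?S\<close>] r in auto)
      thus ?thesis using r by simp
    qed
    thus ?thesis by blast
  qed
  have conv: "convergent (\<lambda>n. D n y h)" if y: "y \<in> ?S" for y h
  proof -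
    have "Cauchy (\<lambda>n. D n y h)"
    proof (rule metric_CauchyI)
      fix e :: real assume e: "e > 0"
      hence "e / (norm h + 1) > 0" by (simp add: add_nonneg_pos)
      from uc[OF this] y obtain N where
        N: "\<And>m n. m \<ge> N \<Longrightarrow> n \<ge> N \<Longrightarrow> norm (D m y h - D n y h) \<le> e / (norm h + 1) * norm h"
        by blast
      have "norm h < norm h + 1" by simp
      hence "e / (norm h + 1) * norm h < e / (norm h + 1) * (norm h + 1)"
        using \<open>e / (norm h + 1) > 0\<close> by (rule mult_strict_left_mono)
      hence less: "e / (norm h + 1) * norm h < e"
        using add_nonneg_pos[OF norm_ge_zero[of h] zero_less_one] by simp
      thus "\<exists>N. \<forall>m\<ge>N. \<forall>n\<ge>N. dist (D m y h) (D n y h) < e"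
        using order_le_less_trans[OF N less] unfolding dist_norm by blast
    qed
    thus ?thesis by (rule Cauchy_convergent)
  qed
  define G where "G = (\<lambda>y h. lim (\<lambda>n. D n y h))"
  have G: "(\<lambda>n. D n y h) \<longlonglongrightarrow> G y h" if "y \<in> ?S" for y h
    using conv[OF that] unfolding G_def by (simp add: convergent_LIMSEQ_iff)
  have homog: "complex_homogeneous (G y)" if y: "y \<in> ?S" for y
  proof (intro allI)
    fix c h
    have "(\<lambda>n. D n y (c *s h)) \<longlonglongrightarrow> c * G y h"
      using D(2)[OF y] by (auto intro!: tendsto_intros G[OF y])
    thus "G y (c *s h) = c * G y h" using G[OF y] LIMSEQ_unique by blast
  qed
  have pt: "(\<lambda>n. f n y) \<longlonglongrightarrow> g y" if "y \<in> ?S" for y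
    using tendsto_uniform_limitI[OF lim inS[OF that]] .
  have "\<exists>k. \<forall>y\<in>?S. (\<lambda>n. f n y) \<longlonglongrightarrow> k y \<and> (k has_derivative G y) (at y within ?S)"
  proof (rule has_derivative_sequence)
    show "(f n has_derivative D n y) (at y within ?S)" if "y \<in> ?S" for n y
      using D(1)[OF that] by (rule has_derivative_at_withinI)
    show "\<forall>\<^sub>F n in sequentially. \<forall>y\<in>?S. \<forall>h. norm (D n y h - G y h) \<le> e * norm h"
      if "e > 0" for e
    proof -
      from uc[OF that] obtain N where N:
        "\<And>m n y h. m \<ge> N \<Longrightarrow> n \<ge> N \<Longrightarrow> y \<in> ?S \<Longrightarrow> norm (D m y h - D n y h) \<le> e * norm h" by blast
      have "norm (D m y h - G y h) \<le> e * norm h" if "m \<ge> N" "y \<in> ?S" for m y h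
      proof (rule tendsto_upperbound)
        show "(\<lambda>n. norm (D m y h - D n y h)) \<longlonglongrightarrow> norm (D m y h - G y h)"
          by (intro tendsto_intros G that)
        show "\<forall>\<^sub>F n in sequentially. norm (D m y h - D n y h) \<le> e * norm h"
          using N that unfolding eventually_sequentially by blast
      qed simp
      thus ?thesis unfolding eventually_sequentially by blast
    qed
  qed (use r pt[of x] in auto)
  then obtain k where k: "\<And>y. y \<in> ?S \<Longrightarrow> (\<lambda>n. f n y) \<longlonglongrightarrow> k y"
      "\<And>y. y \<in> ?S \<Longrightarrow> (k has_derivative G y) (at y within ?S)" by blast
  have "holomorphic_several k ?S"
    unfolding holomorphic_several_def
    using k(2) homog by (metis at_within_open open_ball)
  moreover have "g y = k y" if "y \<in> ?S" for y
    using k(1)[OF that] pt[OF that] LIMSEQ_unique by blast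
  ultimately show ?thesis by (auto intro: holomorphic_several_transform)
qed

section \<open>Partial derivatives and Taylor coefficients\<close>

definition partial_deriv ::
    "'i::finite \<Rightarrow> (complex ^ 'i \<Rightarrow> complex) \<Rightarrow> complex ^ 'i \<Rightarrow> complex" where
  "partial_deriv d f x = deriv (\<lambda>z. f (coord_upd x d z)) (x $ d)"

text \<open>A rate of convergence that depends on \<open>g\<close> only through its bound \<open>M\<close>, by second order Taylor
  expansion with the Cauchy inequality on discs of radius \<open>r / 2\<close> for the second derivative. This
  uniformity is what makes difference quotients of a function of several variables converge locally
  uniformly.\<close>

lemma difference_quotient_bound:
  assumes g: "g holomorphic_on ball 0 (2 * r)" and r: "r > 0"
    and M: "\<And>z. z \<in> ball 0 (2 * r) \<Longrightarrow> norm (g z) \<le> M"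
    and h: "h \<in> ball 0 r" "h \<noteq> 0"
  shows "norm ((g h - g 0) / h - deriv g 0) \<le> 8 * M / r ^ 2 * norm h"
proof -
  have "norm ((deriv ^^ 0) g h - (\<Sum>i\<le>1. (deriv ^^ i) g 0 * (h - 0) ^ i / fact i))
          \<le> (8 * M / r ^ 2) * norm (h - 0) ^ Suc 1 / fact 1"
  proof (rule complex_Taylor[where S = "ball 0 r"])
    fix i and z :: complex assume "z \<in> ball 0 r"
    hence z: "cmod z < r" by simp
    have "(deriv ^^ i) g holomorphic_on ball 0 (2 * r)"
      by (intro holomorphic_higher_deriv g) auto
    moreover have "z \<in> ball 0 (2 * r)" using z r by simp
    ultimately have "((deriv ^^ i) g has_field_derivative deriv ((deriv ^^ i) g) z) (at z)"
      using holomorphic_derivI open_ball by blast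
    thus "((deriv ^^ i) g has_field_derivative (deriv ^^ Suc i) g z) (at z within ball 0 r)"
      by (simp add: has_field_derivative_at_within)
  next
    fix z :: complex assume "z \<in> ball 0 r"
    hence z: "cmod z < r" by simp
    have sub: "w \<in> ball 0 (2 * r)" if "w \<in> cball z (r / 2)" for w
    proof -
      have "cmod w \<le> cmod z + dist z w" by (metis dist_commute dist_norm norm_triangle_sub)
      thus ?thesis using z r that by simp
    qed
    have hol: "g holomorphic_on cball z (r / 2)"
      using g by (rule holomorphic_on_subset) (use sub in blast)
    have "norm ((deriv ^^ 2) g z) \<le> fact 2 * M / (r / 2) ^ 2"
      by (rule Cauchy_inequality)
         (use r in \<open>auto intro: holomorphic_on_imp_continuous_on[OF hol]
          holomorphic_on_subset[OF hol] intro!: M[OF sub] simp: dist_norm\<close>)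
    thus "cmod ((deriv ^^ Suc 1) g z) \<le> 8 * M / r\<^sup>2"
      by (simp add: numeral_2_eq_2 power2_eq_square field_simps)
  qed (use h r in auto)
  hence "norm (g h - g 0 - deriv g 0 * h) \<le> (8 * M / r ^ 2) * norm h ^ 2"
    by (simp add: numeral_2_eq_2 algebra_simps)
  hence "norm (g h - g 0 - deriv g 0 * h) / norm h \<le> (8 * M / r ^ 2) * norm h"
    using h(2) by (simp add: divide_le_eq power2_eq_square mult.assoc)
  moreover have "(g h - g 0) / h - deriv g 0 = (g h - g 0 - deriv g 0 * h) / h"
    using h(2) by (simp add: field_simps)
  ultimately show ?thesis by (simp add: norm_divide)
qed

lemma partial_deriv_eq:
  assumes "(f has_derivative L) (at x)" "complex_homogeneous L"
  shows "partial_deriv d f x = L (axis d 1)"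
    and "deriv (\<lambda>k. f (x + k *s axis d 1)) 0 = L (axis d 1)"
proof -
  have "((\<lambda>k. f ((x - (x $ d) *s axis d 1) + k *s axis d 1))
           has_field_derivative L (axis d 1)) (at (x $ d))"
    by (rule has_field_derivative_along_line) (use assms in auto)
  thus "partial_deriv d f x = L (axis d 1)"
    unfolding partial_deriv_def coord_upd_line by (rule DERIV_imp_deriv)
  have "((\<lambda>k. f (x + k *s axis d 1)) has_field_derivative L (axis d 1)) (at 0)"
    by (rule has_field_derivative_along_line) (use assms in auto)
  thus "deriv (\<lambda>k. f (x + k *s axis d 1)) 0 = L (axis d 1)" by (rule DERIV_imp_deriv)
qed

text \<open>A partial derivative is a locally uniform limit of difference quotients, and these are
  combinations of translates of \<open>f\<close>.\<close>

lemma holomorphic_several_partial_deriv: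
  assumes U: "open U" and f: "holomorphic_several f U"
  shows "holomorphic_several (partial_deriv d f) U"
proof (rule holomorphic_several_local)
  fix x0 assume "x0 \<in> U"
  with U obtain e where e: "e > 0" "cball x0 e \<subseteq> U" using open_contains_cball by blast
  (* 3 r for the ball of the limit lemma, 2 r for the discs of the difference quotient bound. *)
  define r where "r = e / 5"
  have r: "r > 0" using e by (simp add: r_def)
  have "bounded (f ` cball x0 e)"
    by (intro compact_imp_bounded compact_continuous_image compact_cball
        continuous_on_subset[OF holomorphic_several_continuous_on[OF f]] e)
  then obtain M where M: "\<And>z. z \<in> cball x0 e \<Longrightarrow> norm (f z) \<le> M"
    unfolding bounded_iff by blast
  (* The shift by 2 makes every step shorter than r. *)
  define h where "h = (\<lambda>n::nat. complex_of_real (r / real (n + 2)))"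
  have norm_h: "norm (h n) = r / real (n + 2)" for n
    unfolding h_def norm_of_real using r by simp
  have h: "h n \<in> ball 0 r" "h n \<noteq> 0" for n
  proof -
    have "0 < norm (h n)" "norm (h n) < r"
      unfolding norm_h using r by (auto simp: field_simps add_pos_nonneg)
    thus "h n \<in> ball 0 r" "h n \<noteq> 0" by auto
  qed
  have inU: "x + k *s axis d 1 \<in> cball x0 e" if "x \<in> ball x0 (3 * r)" "k \<in> ball 0 (2 * r)" for x k
  proof -
    have "dist x (x + k *s axis d 1) < 2 * r"
      using that(2) by (simp add: dist_norm norm_scalar_mult_vec)
    thus ?thesis using that(1) dist_triangle[of x0 "x + k *s axis d 1" x] by (simp add: r_def)
  qed
  have "holomorphic_several (partial_deriv d f) (ball x0 r)"
  proof (rule holomorphic_several_uniform_limit_ball)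
    show "holomorphic_several (\<lambda>x. inverse (h n) * (f (x + h n *s axis d 1) - f x))
            (ball x0 (3 * r))" for n
    proof (intro holomorphic_several_cmult holomorphic_several_diff
        holomorphic_several_compose_translation[OF f])
      show "z + h n *s axis d 1 \<in> U" if "z \<in> ball x0 (3 * r)" for z
        using inU[OF that, of "h n"] h[of n] r e(2) by auto
      show "holomorphic_several f (ball x0 (3 * r))"
        by (rule holomorphic_several_subset[OF f]) (use e r_def r in auto)
    qed
    show "uniform_limit (ball x0 (3 * r)) (\<lambda>n x. inverse (h n) * (f (x + h n *s axis d 1) - f x))
            (partial_deriv d f) sequentially"
    proof (rule uniform_limitI)
      fix \<epsilon> :: real assume \<epsilon>: "\<epsilon> > 0"
      have bd: "dist (inverse (h n) * (f (x + h n *s axis d 1) - f x)) (partial_deriv d f x)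
               \<le> 8 * M / r ^ 2 * norm (h n)" if x: "x \<in> ball x0 (3 * r)" for n x
      proof -
        let ?g = "\<lambda>k. f (x + k *s axis d 1)"
        have "x \<in> U" using inU[OF x, of 0] r e(2) by auto
        with f obtain L where "(f has_derivative L) (at x)" "complex_homogeneous L"
          by (rule holomorphic_severalD)
        hence eq: "deriv ?g 0 = partial_deriv d f x" by (simp add: partial_deriv_eq)
        have "norm ((?g (h n) - ?g 0) / h n - deriv ?g 0) \<le> 8 * M / r ^ 2 * norm (h n)"
        proof (rule difference_quotient_bound)
          show "?g holomorphic_on ball 0 (2 * r)"
            by (rule holomorphic_on_line[OF f]) (use inU[OF x] e(2) in blast)
        qed (use r h inU[OF x] M in auto)
        thus ?thesis unfolding eq by (simp add: dist_norm divide_inverse mult.commute)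
      qed
      have "(\<lambda>n. 8 * M / r ^ 2 * norm (h n)) \<longlonglongrightarrow> 0"
        unfolding norm_h by real_asymp
      hence "\<forall>\<^sub>F n in sequentially. 8 * M / r ^ 2 * norm (h n) < \<epsilon>"
        using \<epsilon> by (rule order_tendstoD)
      thus "\<forall>\<^sub>F n in sequentially. \<forall>x\<in>ball x0 (3 * r).
              dist (inverse (h n) * (f (x + h n *s axis d 1) - f x)) (partial_deriv d f x) < \<epsilon>"
        by eventually_elim (use bd in \<open>blast intro: order_le_less_trans\<close>)
    qed
  qed (use r in auto)
  thus "\<exists>r>0. holomorphic_several (partial_deriv d f) (ball x0 r)" using r by blast
qed

lemma holomorphic_several_higher_partial_deriv:
  assumes "open U" "holomorphic_several f U"
  shows "holomorphic_several ((partial_deriv d ^^ j) f) U"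
  by (induction j) (auto intro: holomorphic_several_partial_deriv assms)

text \<open>Iteration commutes with freezing the other coordinates, because replacing the coordinate \<open>d\<close>
  twice has the effect of the second replacement.\<close>

lemma higher_partial_deriv_eq:
  "(partial_deriv d ^^ j) f x = (deriv ^^ j) (\<lambda>z. f (coord_upd x d z)) (x $ d)"
  by (induction j arbitrary: x) (simp_all add: partial_deriv_def coord_upd_nth)

lemma taylor_coeff_eq_partial_deriv:
  "fps_nth (fps_expansion (\<lambda>z. f (coord_upd x d z)) 0) j =
     inverse (fact j) * (partial_deriv d ^^ j) f (coord_upd x d 0)"
  by (simp add: fps_expansion_def higher_partial_deriv_eq coord_upd_nth divide_inverse mult.commute)

lemma holomorphic_several_taylor_coeff:
  assumes "open V" "holomorphic_several f V" "\<And>x. x \<in> U \<Longrightarrow> coord_upd x d 0 \<in> V"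
  shows "holomorphic_several (\<lambda>x. fps_nth (fps_expansion (\<lambda>z. f (coord_upd x d z)) 0) j) U"
  unfolding taylor_coeff_eq_partial_deriv
  by (intro holomorphic_several_cmult holomorphic_several_compose_coord_upd[of _ V]
      holomorphic_several_higher_partial_deriv assms)

section \<open>Polydiscs and bounds on Taylor coefficients\<close>

lemma open_polydisc: "open (polydisc \<rho>)"
proof -
  have "polydisc \<rho> = (\<Inter>d. {z. norm (z $ d) < \<rho> d})" by (auto simp: polydisc_def)
  thus ?thesis by (auto intro!: open_INT open_Collect_less continuous_intros)
qed

lemma coord_upd_in_polydisc:
  assumes "x \<in> polydisc \<rho>" "norm z < \<rho> d"
  shows "coord_upd x d z \<in> polydisc \<rho>"
  using assms by (simp add: polydisc_def coord_upd_nth)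

lemma coord_upd_0_in_polydisc:
  assumes "x \<in> polydisc \<rho>"
  shows "coord_upd x d 0 \<in> polydisc \<rho>"
proof (rule coord_upd_in_polydisc[OF assms])
  have "norm (x $ d) < \<rho> d" using assms by (simp add: polydisc_def)
  thus "norm (0 :: complex) < \<rho> d" using le_less_trans[OF norm_ge_zero] by simp
qed

lemma holI:
  "holomorphic_several f U \<Longrightarrow> (\<And>z. z \<notin> U \<Longrightarrow> f z = 0) \<Longrightarrow> f \<in> hol U"
  by (simp add: hol_def)

lemma continuous_on_coord_upd: "continuous_on A (\<lambda>(x, z). coord_upd x d z)"
  unfolding case_prod_beta coord_upd_def
proof (rule continuous_on_vec_lambda)
  show "continuous_on A (\<lambda>x. if i = d then snd x else fst x $ i)" for i
    by (cases "i = d") (auto intro!: continuous_intros)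
qed

text \<open>A neighbourhood on which the coordinate \<open>d\<close> stays below \<open>q\<close> while the function may still be
  sampled on the larger disc of radius \<open>r\<close>: the gap makes \<open>(q / r) ^ j\<close> a geometric majorant for
  the power series in that coordinate.\<close>

lemma compact_polydisc_enlarge:
  assumes "x0 \<in> polydisc \<rho>"
  obtains \<delta> q r where "\<delta> > 0" "0 < q" "q < r" "cball x0 \<delta> \<subseteq> polydisc \<rho>"
    "\<And>x. x \<in> cball x0 \<delta> \<Longrightarrow> norm (x $ d) \<le> q"
    "\<And>x z. x \<in> cball x0 \<delta> \<Longrightarrow> norm z \<le> r \<Longrightarrow> coord_upd x d z \<in> polydisc \<rho>"
proof -
  obtain e where e: "e > 0" "cball x0 e \<subseteq> polydisc \<rho>"
    using open_polydisc open_contains_cball assms by blast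
  define g where "g = \<rho> d - norm (x0 $ d)"
  have g: "g > 0" using assms by (simp add: g_def polydisc_def)
  define \<delta> where "\<delta> = min e (g / 3)"
  have \<delta>: "\<delta> > 0" "\<delta> \<le> e" "\<delta> \<le> g / 3" using e g by (auto simp: \<delta>_def)
  show thesis
  proof (rule that[of \<delta> "norm (x0 $ d) + g / 3" "norm (x0 $ d) + 2 * g / 3"])
    show sub: "cball x0 \<delta> \<subseteq> polydisc \<rho>" using e \<delta> by auto
    show "norm (x $ d) \<le> norm (x0 $ d) + g / 3" if "x \<in> cball x0 \<delta>" for x
    proof -
      have "norm (x $ d) \<le> norm (x0 $ d) + norm ((x - x0) $ d)"
        using norm_triangle_ineq[of "x0 $ d" "(x - x0) $ d"] by simp
      also have "norm ((x - x0) $ d) \<le> norm (x - x0)" by (rule Finite_Cartesian_Product.norm_nth_le)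
      also have "norm (x - x0) \<le> g / 3" using that \<delta> by (simp add: dist_norm norm_minus_commute)
      finally show ?thesis by simp
    qed
    show "coord_upd x d z \<in> polydisc \<rho>"
      if "x \<in> cball x0 \<delta>" "norm z \<le> norm (x0 $ d) + 2 * g / 3" for x z
    proof (rule coord_upd_in_polydisc)
      show "x \<in> polydisc \<rho>" using that sub by blast
      have "norm (x0 $ d) + 2 * g / 3 < \<rho> d" using g unfolding g_def by argo
      thus "norm z < \<rho> d" using that(2) by linarith
    qed
  qed (use \<delta> g in \<open>auto intro: add_nonneg_pos\<close>)
qed

lemma taylor_coeff_bound:
  assumes f: "holomorphic_several f (polydisc \<rho>)"
    and r: "r > 0" "\<And>z. norm z \<le> r \<Longrightarrow> coord_upd x d z \<in> polydisc \<rho>"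
    and M: "\<And>z. norm z \<le> r \<Longrightarrow> norm (f (coord_upd x d z)) \<le> M"
  shows "norm (fps_nth (fps_expansion (\<lambda>z. f (coord_upd x d z)) 0) j) \<le> M / r ^ j"
proof -
  have hol: "(\<lambda>z. f (coord_upd x d z)) holomorphic_on cball 0 r"
    unfolding coord_upd_line
    by (rule holomorphic_on_line[OF f]) (use r(2) in \<open>auto simp: coord_upd_line\<close>)
  have "norm ((deriv ^^ j) (\<lambda>z. f (coord_upd x d z)) 0) \<le> fact j * M / r ^ j"
    by (rule Cauchy_inequality)
       (use r M in \<open>auto intro: holomorphic_on_imp_continuous_on[OF hol]
          holomorphic_on_subset[OF hol]\<close>)
  thus ?thesis by (simp add: fps_expansion_def norm_divide field_simps)
qed

lemma summable_powr_times_geometric: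
  assumes "0 < q" "q < (1 :: real)"
  shows "summable (\<lambda>j. (real j + 1) powr s * q ^ j)"
proof (rule summable_comparison_test_bigo)
  show "summable (\<lambda>n. norm (1 / real n ^ 2))"
    using inverse_power_summable[of 2, where ?'a = real] by (simp add: inverse_eq_divide)
  show "(\<lambda>j. (real j + 1) powr s * q ^ j) \<in> O(\<lambda>n. 1 / real n ^ 2)"
    using assms by real_asymp
qed

section \<open>Moment differentiation of holomorphic functions\<close>

text \<open>Near a point, the Cauchy bound \<open>M / r ^ j\<close> on the Taylor coefficients leaves a factor
  \<open>(q / r) ^ j\<close> with \<open>q < r\<close>, which beats the polynomial growth of the moment ratios. The Weierstrass
  test thus gives locally uniform convergence of a series with holomorphic terms. Since the moment
  derivative is holomorphic on the same polydisc as \<open>f\<close>, it can be iterated.\<close>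

lemma moment_deriv_x_hol:
  assumes f: "f \<in> hol (polydisc \<rho>)"
    and growth: "\<And>j::nat. norm (m (of_nat (j + 1)) / m (of_nat j)) \<le> A * (real j + 1) powr s"
  shows "moment_deriv_x (polydisc \<rho>) m d f \<in> hol (polydisc \<rho>)"
proof (rule holI)
  have f: "holomorphic_several f (polydisc \<rho>)" using f by (simp add: hol_def)
  define c where "c = (\<lambda>j x. fps_nth (fps_expansion (\<lambda>z. f (coord_upd x d z)) 0) j)"
  define T where "T = (\<lambda>j x. m (of_nat (j + 1)) / m (of_nat j) * c (j + 1) x * (x $ d) ^ j)"
  have eq: "moment_deriv_x (polydisc \<rho>) m d f x = (\<Sum>j. T j x)" if "x \<in> polydisc \<rho>" for x
    using that unfolding moment_deriv_x_def eval_fps_def moment_deriv_def T_def c_def coord_upd_def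
    by simp
  have c_hol: "holomorphic_several (c j) (polydisc \<rho>)" for j
    unfolding c_def
    by (rule holomorphic_several_taylor_coeff[OF open_polydisc f coord_upd_0_in_polydisc])
  have T_hol: "holomorphic_several (T j) (polydisc \<rho>)" for j
    unfolding T_def
    by (intro holomorphic_several_mult holomorphic_several_const c_hol holomorphic_several_power
        holomorphic_several_coord)
  show "holomorphic_several (moment_deriv_x (polydisc \<rho>) m d f) (polydisc \<rho>)"
  proof (rule holomorphic_several_local)
    fix x0 assume "x0 \<in> polydisc \<rho>"
    then obtain \<delta> q r where \<delta>: "\<delta> > 0" "0 < q" "q < r" "cball x0 \<delta> \<subseteq> polydisc \<rho>"
      "\<And>x. x \<in> cball x0 \<delta> \<Longrightarrow> norm (x $ d) \<le> q"
      "\<And>x z. x \<in> cball x0 \<delta> \<Longrightarrow> norm z \<le> r \<Longrightarrow> coord_upd x d z \<in> polydisc \<rho>"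
      by (rule compact_polydisc_enlarge[of x0 \<rho> d]) (rule that)
    have r: "r > 0" using \<delta> by simp
    let ?K = "(\<lambda>(x, z). coord_upd x d z) ` (cball x0 \<delta> \<times> cball 0 r)"
    have "compact ?K"
      by (intro compact_continuous_image continuous_on_coord_upd compact_Times compact_cball)
    moreover have "continuous_on ?K f"
      by (rule continuous_on_subset[OF holomorphic_several_continuous_on[OF f]]) (use \<delta>(6) in auto)
    ultimately have "bounded (f ` ?K)"
      using compact_continuous_image compact_imp_bounded by blast
    then obtain M where M: "\<And>y. y \<in> ?K \<Longrightarrow> norm (f y) \<le> M"
      unfolding bounded_iff by blast
    have c_bound: "norm (c j x) \<le> M / r ^ j" if "x \<in> cball x0 \<delta>" for j x
      unfolding c_def
      by (rule taylor_coeff_bound[OF f r]) (use that \<delta>(6) in \<open>auto intro!: M\<close>)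
    have "uniform_limit (cball x0 \<delta>) (\<lambda>n x. \<Sum>j<n. T j x) (\<lambda>x. \<Sum>j. T j x) sequentially"
    proof (rule Weierstrass_m_test)
      show "summable (\<lambda>j. (A * M / r) * ((real j + 1) powr s * (q / r) ^ j))"
        by (intro summable_mult summable_powr_times_geometric) (use \<delta> in auto)
      show "norm (T j x) \<le> (A * M / r) * ((real j + 1) powr s * (q / r) ^ j)"
        if x: "x \<in> cball x0 \<delta>" for j x
      proof -
        have nonneg: "0 \<le> A * (real j + 1) powr s" "0 \<le> M / r ^ (j + 1)"
          by (rule order_trans[OF norm_ge_zero growth],
              rule order_trans[OF norm_ge_zero c_bound[OF x]])
        have "norm (x $ d) ^ j \<le> q ^ j" by (intro power_mono \<delta>(5)[OF x] norm_ge_zero)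
        moreover have "norm (m (of_nat (j + 1)) / m (of_nat j)) * norm (c (j + 1) x)
                         \<le> A * (real j + 1) powr s * (M / r ^ (j + 1))"
          by (rule mult_mono[OF growth c_bound[OF x] nonneg(1) norm_ge_zero])
        ultimately have "norm (T j x) \<le> A * (real j + 1) powr s * (M / r ^ (j + 1)) * q ^ j"
          using mult_nonneg_nonneg[OF nonneg] unfolding T_def norm_mult norm_power
          by (intro mult_mono[where b = "A * (real j + 1) powr s * (M / r ^ (j + 1))"]) simp_all
        also have "\<dots> = (A * M / r) * ((real j + 1) powr s * (q / r) ^ j)"
          by (simp add: power_divide)
        finally show ?thesis .
      qed
    qed
    hence lim: "uniform_limit (ball x0 (3 * (\<delta> / 3))) (\<lambda>n x. \<Sum>j<n. T j x)
        (\<lambda>x. \<Sum>j. T j x) sequentially"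
      by (rule uniform_limit_on_subset) auto
    have sub: "ball x0 \<delta> \<subseteq> polydisc \<rho>" using \<delta>(4) ball_subset_cball by blast
    have "holomorphic_several (\<lambda>x. \<Sum>j. T j x) (ball x0 (\<delta> / 3))"
      by (rule holomorphic_several_uniform_limit_ball[OF _ _ lim])
         (use \<delta>(1) sub in \<open>auto intro!: holomorphic_several_sum holomorphic_several_subset[OF T_hol]\<close>)
    hence "holomorphic_several (moment_deriv_x (polydisc \<rho>) m d f) (ball x0 (\<delta> / 3))"
      by (rule holomorphic_several_transform) (use sub \<delta>(1) in \<open>auto intro!: eq\<close>)
    thus "\<exists>r>0. holomorphic_several (moment_deriv_x (polydisc \<rho>) m d f) (ball x0 r)"
      using \<delta>(1) by (intro exI[of _ "\<delta> / 3"]) auto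
  qed
qed (simp add: moment_deriv_x_def)

lemma moment_deriv_multi_hol:
  assumes f: "f \<in> hol (polydisc \<rho>)"
    and growth: "\<And>d. \<exists>A s. \<forall>j::nat. norm (m d (of_nat (j + 1)) / m d (of_nat j)) \<le> A * (real j + 1) powr s"
  shows "moment_deriv_multi (polydisc \<rho>) m q f \<in> hol (polydisc \<rho>)"
proof -
  have "moment_deriv_x (polydisc \<rho>) (m d) d g \<in> hol (polydisc \<rho>)" if "g \<in> hol (polydisc \<rho>)" for d g
    using growth[of d] moment_deriv_x_hol[OF that] by blast
  hence step: "(moment_deriv_x (polydisc \<rho>) (m d) d ^^ k) g \<in> hol (polydisc \<rho>)"
    if "g \<in> hol (polydisc \<rho>)" for d k g
    using that by (induction k) auto
  have "foldr (\<circ>) (map (\<lambda>d. moment_deriv_x (polydisc \<rho>) (m d) d ^^ (q $ d)) ds) id f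
          \<in> hol (polydisc \<rho>)" for ds
    by (induction ds) (auto intro: step f)
  thus ?thesis by (simp add: moment_deriv_multi_def)
qed

text \<open>Up to factorials, the coefficients are the partial derivatives in \<open>t\<close>, restricted to \<open>t = 0\<close>.
  Outside the polydisc in \<open>x\<close> no \<open>(t, x)\<close> lies in the domain of \<open>a\<close>, so they vanish there.\<close>

lemma taylor_t_hol_fps:
  assumes a: "a \<in> hol (polydisc (case_option \<rho>\<^sub>0 \<rho>))" and \<rho>\<^sub>0: "\<rho>\<^sub>0 > 0"
  shows "taylor_t a \<in> hol_fps (polydisc \<rho>)"
proof -
  have "(\<lambda>x. fps_nth (fps_expansion (\<lambda>t. a (tx t x)) 0) j) \<in> hol (polydisc \<rho>)" for j
  proof (rule holI)
    have tx: "tx t x = coord_upd (tx 0 x) None t" for t and x :: "complex ^ 'a"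
      by (simp add: tx_def coord_upd_def vec_eq_iff split: option.splits)
    have tx_in: "tx 0 x \<in> polydisc (case_option \<rho>\<^sub>0 \<rho>)" if "x \<in> polydisc \<rho>" for x
      using that \<rho>\<^sub>0 by (auto simp: polydisc_def tx_def split: option.splits)
    have "holomorphic_several (\<lambda>x. (\<lambda>y. fps_nth (fps_expansion
            (\<lambda>z. a (coord_upd y None z)) 0) j) (tx 0 x)) (polydisc \<rho>)"
      by (rule holomorphic_several_compose_tx[of _ "polydisc (case_option \<rho>\<^sub>0 \<rho>)"],
          rule holomorphic_several_taylor_coeff[OF open_polydisc[of "case_option \<rho>\<^sub>0 \<rho>"]])
         (use a tx_in coord_upd_0_in_polydisc in \<open>auto simp: hol_def\<close>)
    thus "holomorphic_several (\<lambda>x. fps_nth (fps_expansion (\<lambda>t. a (tx t x)) 0) j) (polydisc \<rho>)"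
      by (simp flip: tx)
  next
    fix x assume "x \<notin> polydisc \<rho>"
    then obtain d where "\<not> norm (x $ d) < \<rho> d" by (auto simp: polydisc_def)
    hence "\<not> norm (tx t x $ Some d) < case_option \<rho>\<^sub>0 \<rho> (Some d)" for t by (simp add: tx_def)
    hence "tx t x \<notin> polydisc (case_option \<rho>\<^sub>0 \<rho>)" for t unfolding polydisc_def by blast
    hence "a (tx t x) = 0" for t using a by (simp add: hol_def)
    moreover have "(deriv ^^ j) (\<lambda>_. 0 :: complex) 0 = 0" by (simp add: higher_deriv_const)
    ultimately show "fps_nth (fps_expansion (\<lambda>t. a (tx t x)) 0) j = 0"
      by (simp add: fps_expansion_def)
  qed
  thus ?thesis by (simp add: hol_fps_def taylor_t_def)
qed

section \<open>Moment functions at the natural numbers\<close>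

text \<open>Regularity bounds only the real parts of the ratios \<open>m (j + 1) / m j\<close>. An upper bound for their
  absolute values follows because the kernel \<open>e\<close>, and hence its moments of integer order, are real.
  Where the integral diverges, its default value \<open>0\<close> is real as well.\<close>

lemma moment_of_real:
  assumes "\<And>t. t > 0 \<Longrightarrow> e t \<in> \<real>"
  shows "moment_of e (of_nat j) \<in> \<real>"
proof -
  let ?g = "\<lambda>t. of_real t powr (of_nat j - 1) * e t"
  have "indicator {0<..} t *\<^sub>R ?g t = of_real (indicator {0<..} t * Re (?g t))" for t :: real
  proof (cases "t > 0")
    case True
    have "complex_of_real t powr (of_nat j - 1) = complex_of_real (t powr (real j - 1))"
      using powr_of_real[of t "real j - 1"] True by simp
    hence "?g t \<in> \<real>" using assms[OF True] by simp
    hence "?g t = of_real (Re (?g t))" by (rule of_real_Re[symmetric])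
    thus ?thesis using True by (simp only: indicator_simps greaterThan_iff mult_1 scaleR_one if_True)
  qed simp
  hence "moment_of e (of_nat j) = of_real (integral\<^sup>L lborel (\<lambda>t. indicator {0<..} t * Re (?g t)))"
    unfolding moment_of_def set_lebesgue_integral_def by (simp only: integral_complex_of_real)
  thus ?thesis by simp
qed

lemma moment_function_real:
  assumes "moment_function s m"
  shows "m (of_nat j) \<in> \<real>"
proof -
  from assms obtain p e E where p: "kernel_pair (s / real p) e E"
    "\<forall>z. Re z \<ge> 0 \<longrightarrow> m z = moment_of (\<lambda>t. e (of_real (t powr (1 / real p))) / of_nat p) z"
    unfolding moment_function_def by blast
  have "e (of_real t) \<in> \<real>" if "t > 0" for t
    using p(1) that unfolding kernel_pair_def by blast
  hence "moment_of (\<lambda>t. e (of_real (t powr (1 / real p))) / of_nat p) (of_nat j) \<in> \<real>"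
    by (intro moment_of_real) (auto intro!: Reals_divide)
  thus ?thesis using p(2) by simp
qed

text \<open>The lower bound on the ratios is positive, whereas division by \<open>0\<close> would give the ratio \<open>0\<close>.\<close>

lemma regular_moment_function_nonzero:
  assumes "regular_moment_function s m"
  shows "m (of_nat j) \<noteq> 0"
proof
  assume zero: "m (of_nat j) = 0"
  from assms obtain a where a: "a > 0"
    "\<And>j::nat. a * (real j + 1) powr s \<le> Re (m (of_nat (j + 1)) / m (of_nat j))"
    unfolding regular_moment_function_def by blast
  have "0 < a * (real j + 1) powr s" using a(1) by simp
  with a(2)[of j] zero show False by simp
qed

lemma regular_moment_function_growth:
  assumes "regular_moment_function s m"
  shows "\<exists>A s. \<forall>j::nat. norm (m (of_nat (j + 1)) / m (of_nat j)) \<le> A * (real j + 1) powr s"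
proof -
  from assms obtain a A where A: "a > 0"
    "\<And>j::nat. a * (real j + 1) powr s \<le> Re (m (of_nat (j + 1)) / m (of_nat j))"
    "\<And>j::nat. Re (m (of_nat (j + 1)) / m (of_nat j)) \<le> A * (real j + 1) powr s"
    unfolding regular_moment_function_def by blast
  have "norm (m (of_nat (j + 1)) / m (of_nat j)) \<le> A * (real j + 1) powr s" for j :: nat
  proof -
    have "m (of_nat (j + 1)) / m (of_nat j) \<in> \<real>"
      using assms unfolding regular_moment_function_def
      by (intro Reals_divide) (blast intro: moment_function_real)+
    then obtain q where q: "m (of_nat (j + 1)) / m (of_nat j) = of_real q" by (elim Reals_cases)
    have "0 < a * (real j + 1) powr s" using A(1) by simp
    with A(2,3)[of j] show ?thesis unfolding q by simp
  qed
  thus ?thesis by blast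
qed

section \<open>Causal recursions\<close>

text \<open>If entry \<open>k\<close> of \<open>G u\<close> depends only on earlier entries of \<open>u\<close>, then iterating \<open>G\<close> from any
  start fixes one more entry in every round. Starting inside \<open>S\<close> keeps the fixpoint in \<open>S\<close>.\<close>

lemma strictly_causal_fixpoint:
  fixes G :: "(nat \<Rightarrow> 'a) \<Rightarrow> nat \<Rightarrow> 'a"
  assumes causal: "\<And>u w k. (\<And>i. i < k \<Longrightarrow> u i = w i) \<Longrightarrow> G u k = G w k"
    and S: "S \<noteq> {}" "\<And>u k. (\<And>i. u i \<in> S) \<Longrightarrow> G u k \<in> S"
  shows "\<exists>!u. (\<forall>k. u k \<in> S) \<and> u = G u"
proof -
  from S(1) obtain z where z: "z \<in> S" by blast
  define it where "it = (\<lambda>n. (G ^^ n) (\<lambda>_. z))"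
  have it_S: "it n i \<in> S" for n i
    unfolding it_def by (induction n arbitrary: i) (auto intro: z S(2))
  have step: "it (Suc n) i = it n i" if "i < n" for n i
    using that
  proof (induction n arbitrary: i)
    case (Suc n)
    have "G (it (Suc n)) i = G (it n) i"
      by (rule causal) (use Suc in auto)
    thus ?case by (simp add: it_def)
  qed simp
  have stable: "it n i = it (Suc i) i" if "Suc i \<le> n" for n i
    using that by (induction n rule: dec_induct) (simp_all add: step)
  define u where "u = (\<lambda>i. it (Suc i) i)"
  have "G u k = u k" for k
  proof -
    have "G u k = G (it k) k"
    proof (rule causal)
      show "u i = it k i" if "i < k" for i
        unfolding u_def using stable[symmetric] that by (simp only: Suc_le_eq)
    qed
    thus ?thesis by (simp add: u_def it_def)
  qed
  hence fix_u: "u = G u" by (intro ext) simp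
  show ?thesis
  proof (rule ex1I[of _ u])
    show "(\<forall>k. u k \<in> S) \<and> u = G u"
      using it_S fix_u unfolding u_def by (intro conjI allI)
  next
    fix w assume w: "(\<forall>k. w k \<in> S) \<and> w = G w"
    show "w = u"
    proof
      fix k
      show "w k = u k"
      proof (induction k rule: less_induct)
        case (less k)
        have "G w k = G u k" using less by (rule causal)
        thus ?case using w fix_u by metis
      qed
    qed
  qed
qed

definition fps_eq_upto :: "nat \<Rightarrow> 'a::zero fps \<Rightarrow> 'a fps \<Rightarrow> bool" where
  "fps_eq_upto k f g \<longleftrightarrow> (\<forall>i\<le>k. fps_nth f i = fps_nth g i)"

lemma fps_eq_upto_refl: "fps_eq_upto k f f"
  by (simp add: fps_eq_upto_def)

lemma fps_eq_upto_mult: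
  fixes f :: "'a::semiring_0 fps"
  assumes "fps_eq_upto k f f'" "fps_eq_upto k g g'"
  shows "fps_eq_upto k (f * g) (f' * g')"
  using assms by (auto simp: fps_eq_upto_def fps_mult_nth intro!: sum.cong)

lemma fps_eq_upto_power:
  fixes f :: "'a::comm_semiring_1 fps"
  shows "fps_eq_upto k f f' \<Longrightarrow> fps_eq_upto k (f ^ n) (f' ^ n)"
  by (induction n) (auto intro: fps_eq_upto_refl fps_eq_upto_mult)

lemma fps_eq_upto_prod:
  fixes f :: "'b \<Rightarrow> 'a::comm_semiring_1 fps"
  shows "(\<And>i. i \<in> A \<Longrightarrow> fps_eq_upto k (f i) (f' i)) \<Longrightarrow> fps_eq_upto k (prod f A) (prod f' A)"
  by (induction A rule: infinite_finite_induct) (auto intro: fps_eq_upto_refl fps_eq_upto_mult)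

lemma fps_eq_upto_sum:
  fixes f :: "'b \<Rightarrow> 'a::comm_monoid_add fps"
  assumes "\<And>i. i \<in> A \<Longrightarrow> fps_eq_upto k (f i) (f' i)"
  shows "fps_eq_upto k (sum f A) (sum f' A)"
  using assms by (auto simp: fps_eq_upto_def fps_sum_nth intro!: sum.cong)

lemma sum_closed:
  assumes "0 \<in> C" "\<And>x y. x \<in> C \<Longrightarrow> y \<in> C \<Longrightarrow> x + y \<in> C" "\<And>i. i \<in> A \<Longrightarrow> f i \<in> C"
  shows "sum f A \<in> C"
  using assms(3) by (induction A rule: infinite_finite_induct) (auto intro: assms(1,2))

lemma fps_nth_mult_closed:
  fixes f g :: "'a::semiring_0 fps"
  assumes "0 \<in> C" "\<And>x y. x \<in> C \<Longrightarrow> y \<in> C \<Longrightarrow> x + y \<in> C"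
    and "\<And>x y. x \<in> A \<Longrightarrow> y \<in> B \<Longrightarrow> x * y \<in> C"
    and "\<And>j. fps_nth f j \<in> A" "\<And>j. fps_nth g j \<in> B"
  shows "fps_nth (f * g) k \<in> C"
  unfolding fps_mult_nth by (rule sum_closed) (use assms in auto)

text \<open>The product of the consecutive ratios telescopes.\<close>

lemma fps_nth_moment_deriv_t_power:
  assumes "\<forall>j::nat. m (of_nat j) \<noteq> 0"
  shows "fps_nth ((moment_deriv_t m ^^ i) u) j =
           (\<lambda>x. m (of_nat (j + i)) / m (of_nat j) * fps_nth u (j + i) x)"
proof (induction i arbitrary: j)
  case 0
  show ?case using assms by simp
next
  case (Suc i)
  have "fps_nth ((moment_deriv_t m ^^ Suc i) u) j =
          (\<lambda>x. m (of_nat (j + 1)) * fps_nth ((moment_deriv_t m ^^ i) u) (j + 1) x / m (of_nat j))"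
    by (simp add: moment_deriv_t_def moment_deriv_def)
  also have "\<dots> = (\<lambda>x. m (of_nat (j + Suc i)) / m (of_nat j) * fps_nth u (j + Suc i) x)"
    unfolding Suc using assms[rule_format, of "j + 1"] by (intro ext) simp
  finally show ?case .
qed

section \<open>The nonlinear part of the equation\<close>

definition nonlinear_part ::
    "(complex ^ 'n::{finite,linorder}) set \<Rightarrow> (complex \<Rightarrow> complex) \<Rightarrow> ('n \<Rightarrow> complex \<Rightarrow> complex) \<Rightarrow>
     nat set \<Rightarrow> (nat \<Rightarrow> 'n multi_index set) \<Rightarrow> ('n multi_index \<Rightarrow> nat) \<Rightarrow>
     ('n multi_index \<Rightarrow> complex ^ 'n option \<Rightarrow> complex) \<Rightarrow>
     (complex ^ 'n::_ \<Rightarrow> complex) fps \<Rightarrow> (complex ^ 'n::_ \<Rightarrow> complex) fps" where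
  "nonlinear_part U m\<^sub>0 m I \<Lambda> v a u =
     (\<Sum>n\<in>I. \<Sum>T\<in>\<Lambda> n. fps_X ^ v T * taylor_t (a T) *
        (\<Prod>l<n. case T ! l of (i, q, r) \<Rightarrow>
           ((moment_deriv_t m\<^sub>0 ^^ i) (moment_deriv_multi_fps U m q u)) ^ r))"

lemma admissible_nth:
  assumes "admissible \<kappa> n T" "l < n" "T ! l = (i, q, r)"
  shows "i < \<kappa>"
  using assms nth_mem[of l T] unfolding admissible_def by auto

text \<open>The coefficient of index \<open>j\<close> of a derivative of order \<open>i < \<kappa>\<close> in \<open>t\<close> comes from the coefficient
  of index \<open>j + i < k + \<kappa>\<close> for \<open>j \<le> k\<close>, whereas the derivatives in \<open>x\<close> act on each coefficient
  separately.\<close>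

lemma nonlinear_part_causal:
  assumes nz: "\<forall>j::nat. m\<^sub>0 (of_nat j) \<noteq> 0"
    and adm: "\<And>n T. n \<in> I \<Longrightarrow> T \<in> \<Lambda> n \<Longrightarrow> admissible \<kappa> n T"
    and agree: "\<And>i. i < k + \<kappa> \<Longrightarrow> fps_nth u i = fps_nth w i"
  shows "fps_nth (nonlinear_part U m\<^sub>0 m I \<Lambda> v a u) k = fps_nth (nonlinear_part U m\<^sub>0 m I \<Lambda> v a w) k"
proof -
  have factor: "fps_eq_upto k ((moment_deriv_t m\<^sub>0 ^^ i) (moment_deriv_multi_fps U m q u))
              ((moment_deriv_t m\<^sub>0 ^^ i) (moment_deriv_multi_fps U m q w))" if "i < \<kappa>" for i q
    using agree that
    by (simp add: fps_eq_upto_def fps_nth_moment_deriv_t_power[OF nz] moment_deriv_multi_fps_def)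
  have "fps_eq_upto k (nonlinear_part U m\<^sub>0 m I \<Lambda> v a u) (nonlinear_part U m\<^sub>0 m I \<Lambda> v a w)"
    unfolding nonlinear_part_def
    by (intro fps_eq_upto_sum fps_eq_upto_mult fps_eq_upto_prod fps_eq_upto_refl)
       (auto split: prod.splits intro!: fps_eq_upto_power factor dest: admissible_nth[OF adm])
  thus ?thesis by (simp add: fps_eq_upto_def)
qed

lemma hol_zero: "0 \<in> hol U"
  by (simp add: hol_def zero_fun_def holomorphic_several_const)

lemma hol_add: "f \<in> hol U \<Longrightarrow> g \<in> hol U \<Longrightarrow> f + g \<in> hol U"
  by (simp add: hol_def plus_fun_def holomorphic_several_add)

lemma hol_cmult: "f \<in> hol U \<Longrightarrow> (\<lambda>x. c * f x) \<in> hol U"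
  by (simp add: hol_def holomorphic_several_cmult)

lemma hol_mult_holomorphic: "f \<in> hol U \<Longrightarrow> holomorphic_several g U \<Longrightarrow> f * g \<in> hol U"
  by (simp add: hol_def times_fun_def holomorphic_several_mult)

lemma fps_mult_holomorphic:
  assumes "\<And>j. holomorphic_several (fps_nth f j) U" "\<And>j. holomorphic_several (fps_nth g j) U"
  shows "holomorphic_several (fps_nth (f * g) k) U"
proof -
  have "fps_nth (f * g) k \<in> {h. holomorphic_several h U}"
    by (rule fps_nth_mult_closed[where A = "{h. holomorphic_several h U}"
          and B = "{h. holomorphic_several h U}"])
       (use assms in \<open>auto simp: zero_fun_def plus_fun_def times_fun_def
          intro: holomorphic_several_const holomorphic_several_add holomorphic_several_mult\<close>)
  thus ?thesis by simp
qed

lemma fps_one_holomorphic: "holomorphic_several (fps_nth 1 k) U"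
  by (simp add: zero_fun_def one_fun_def holomorphic_several_const)

lemma fps_power_holomorphic:
  assumes "\<And>j. holomorphic_several (fps_nth f j) U"
  shows "holomorphic_several (fps_nth (f ^ n) k) U"
  by (induction n arbitrary: k)
     (auto simp del: fps_one_nth intro: fps_one_holomorphic fps_mult_holomorphic assms)

lemma fps_prod_holomorphic:
  assumes "\<And>i j. i \<in> A \<Longrightarrow> holomorphic_several (fps_nth (f i) j) U"
  shows "holomorphic_several (fps_nth (prod f A) k) U"
  using assms
  by (induction A arbitrary: k rule: infinite_finite_induct)
     (auto simp del: fps_one_nth intro: fps_one_holomorphic fps_mult_holomorphic)

text \<open>Empty products and zeroth powers are the constant \<open>1\<close>, which does not vanish outside \<open>U\<close>. So the
  product of the derivatives is shown to be holomorphic on \<open>U\<close>, and the factor \<open>taylor_t (a T)\<close>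
  makes the whole term vanish outside.\<close>

lemma nonlinear_part_hol:
  assumes nz: "\<forall>j::nat. m\<^sub>0 (of_nat j) \<noteq> 0"
    and D: "\<And>q g. g \<in> hol U \<Longrightarrow> moment_deriv_multi U m q g \<in> hol U"
    and a: "\<And>n T. n \<in> I \<Longrightarrow> T \<in> \<Lambda> n \<Longrightarrow> taylor_t (a T) \<in> hol_fps U"
    and u: "u \<in> hol_fps U"
  shows "fps_nth (nonlinear_part U m\<^sub>0 m I \<Lambda> v a u) k \<in> hol U"
proof -
  have factor: "holomorphic_several
      (fps_nth ((moment_deriv_t m\<^sub>0 ^^ i) (moment_deriv_multi_fps U m q u)) j) U" for i q j
    using D u unfolding fps_nth_moment_deriv_t_power[OF nz]
    by (intro holomorphic_several_cmult) (simp add: moment_deriv_multi_fps_def hol_fps_def hol_def)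
  have coeff: "fps_nth (fps_X ^ v T * taylor_t (a T)) j \<in> hol U" if "n \<in> I" "T \<in> \<Lambda> n" for n T j
    using a[OF that] by (simp add: fps_X_power_mult_nth hol_fps_def hol_zero)
  have "fps_nth (fps_X ^ v T * taylor_t (a T) *
        (\<Prod>l<n. case T ! l of (i, q, r) \<Rightarrow>
           ((moment_deriv_t m\<^sub>0 ^^ i) (moment_deriv_multi_fps U m q u)) ^ r)) j \<in> hol U"
    if "n \<in> I" "T \<in> \<Lambda> n" for n T j
    by (rule fps_nth_mult_closed[where A = "hol U" and B = "{h. holomorphic_several h U}"])
       (use that in \<open>auto intro!: hol_zero hol_add hol_mult_holomorphic coeff fps_prod_holomorphic
          fps_power_holomorphic factor split: prod.splits\<close>)
  thus ?thesis
    unfolding nonlinear_part_def fps_sum_nth by (auto intro!: sum_closed hol_zero hol_add)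
qed

text \<open>The coefficients of index below \<open>\<kappa>\<close> are the initial conditions, and for \<open>k \<ge> \<kappa>\<close> the equation at
  index \<open>k - \<kappa>\<close> is solved for the coefficient of index \<open>k\<close>, which is possible since no moment
  vanishes.\<close>

lemma formal_solution_iff_recursion:
  assumes nz: "\<forall>j::nat. m\<^sub>0 (of_nat j) \<noteq> 0"
  shows "formal_solution U m\<^sub>0 m \<kappa> I \<Lambda> v a f \<phi> u \<longleftrightarrow> u \<in> hol_fps U \<and>
    fps_nth u = (\<lambda>k. if k < \<kappa> then (\<lambda>x. m\<^sub>0 0 / m\<^sub>0 (of_nat k) * \<phi> k x)
      else (\<lambda>x. m\<^sub>0 (of_nat (k - \<kappa>)) / m\<^sub>0 (of_nat k) *
        (fps_nth f (k - \<kappa>) + fps_nth (nonlinear_part U m\<^sub>0 m I \<Lambda> v a u) (k - \<kappa>)) x))"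
    (is "_ \<longleftrightarrow> _ \<and> fps_nth u = ?G")
proof -
  let ?N = "nonlinear_part U m\<^sub>0 m I \<Lambda> v a u"
  have solve: "\<mu> / \<nu> * y = z \<longleftrightarrow> y = \<nu> / \<mu> * z" if "\<mu> \<noteq> 0" "\<nu> \<noteq> 0" for \<mu> \<nu> y z :: complex
    using that by (auto simp: field_simps)
  have eq: "(moment_deriv_t m\<^sub>0 ^^ \<kappa>) u - ?N = f \<longleftrightarrow> (\<forall>k\<ge>\<kappa>. fps_nth u k = ?G k)"
  proof -
    have "(moment_deriv_t m\<^sub>0 ^^ \<kappa>) u - ?N = f \<longleftrightarrow> (moment_deriv_t m\<^sub>0 ^^ \<kappa>) u = f + ?N"
      by (rule diff_eq_eq)
    also have "\<dots> \<longleftrightarrow> (\<forall>j x. m\<^sub>0 (of_nat (j + \<kappa>)) / m\<^sub>0 (of_nat j) * fps_nth u (j + \<kappa>) x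
                        = (fps_nth f j + fps_nth ?N j) x)"
      unfolding fps_eq_iff fps_nth_moment_deriv_t_power[OF nz] fps_add_nth fun_eq_iff ..
    also have "\<dots> \<longleftrightarrow> (\<forall>j x. fps_nth u (j + \<kappa>) x = m\<^sub>0 (of_nat j) / m\<^sub>0 (of_nat (j + \<kappa>)) *
                          (fps_nth f j + fps_nth ?N j) x)"
      by (simp only: solve nz[rule_format] simp_thms)
    also have "\<dots> \<longleftrightarrow> (\<forall>j. fps_nth u (j + \<kappa>) = ?G (j + \<kappa>))"
      unfolding fun_eq_iff by simp
    also have "\<dots> \<longleftrightarrow> (\<forall>k\<ge>\<kappa>. fps_nth u k = ?G k)"
      by (metis le_add2 le_add_diff_inverse2)
    finally show ?thesis .
  qed
  have init: "(\<forall>j<\<kappa>. fps_nth ((moment_deriv_t m\<^sub>0 ^^ j) u) 0 = \<phi> j) \<longleftrightarrow> (\<forall>k<\<kappa>. fps_nth u k = ?G k)"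
  proof -
    have "fps_nth ((moment_deriv_t m\<^sub>0 ^^ j) u) 0 = \<phi> j \<longleftrightarrow>
            fps_nth u j = (\<lambda>x. m\<^sub>0 0 / m\<^sub>0 (of_nat j) * \<phi> j x)" for j
      using solve[OF nz[rule_format, of j] nz[rule_format, of 0]]
      unfolding fps_nth_moment_deriv_t_power[OF nz] fun_eq_iff by simp
    thus ?thesis by simp
  qed
  have "(\<forall>k<\<kappa>. fps_nth u k = ?G k) \<and> (\<forall>k\<ge>\<kappa>. fps_nth u k = ?G k) \<longleftrightarrow> fps_nth u = ?G"
    unfolding fun_eq_iff[of "fps_nth u"] by (meson not_le)
  thus ?thesis
    unfolding formal_solution_def init nonlinear_part_def[symmetric] eq by blast
qed

theorem proposition5p1:
  fixes s\<^sub>0 \<rho>\<^sub>0 :: real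
    and s \<rho> :: "'n::{finite,linorder} \<Rightarrow> real"
    and m\<^sub>0 :: "complex \<Rightarrow> complex"
    and m :: "'n \<Rightarrow> complex \<Rightarrow> complex"
    and \<kappa> :: nat
    and I :: "nat set"
    and \<Lambda> :: "nat \<Rightarrow> 'n multi_index set"
    and v :: "'n multi_index \<Rightarrow> nat"
    and a :: "'n multi_index \<Rightarrow> complex ^ 'n option \<Rightarrow> complex"
    and f :: "(complex ^ 'n::_ \<Rightarrow> complex) fps"
    and \<phi> :: "nat \<Rightarrow> complex ^ 'n::_ \<Rightarrow> complex"
  assumes "s\<^sub>0 > 0" and "\<And>d. s d \<ge> 1"
    and "regular_moment_function s\<^sub>0 m\<^sub>0"
    and "\<And>d. regular_moment_function (s d) (m d)"
    and "\<rho>\<^sub>0 > 0" and "\<And>d. \<rho> d > 0"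
    and "\<kappa> \<ge> 1"
    and "finite I" and "I \<noteq> {}" and "0 \<notin> I"
    and "\<And>n. n \<in> I \<Longrightarrow> finite (\<Lambda> n) \<and> \<Lambda> n \<noteq> {}"
    and "\<And>n T. n \<in> I \<Longrightarrow> T \<in> \<Lambda> n \<Longrightarrow> admissible \<kappa> n T"
    and "\<And>n T. n \<in> I \<Longrightarrow> T \<in> \<Lambda> n \<Longrightarrow> a T \<in> hol (polydisc (case_option \<rho>\<^sub>0 \<rho>))"
    and "\<And>n T. n \<in> I \<Longrightarrow> T \<in> \<Lambda> n \<Longrightarrow> \<exists>x \<in> polydisc \<rho>. a T (tx 0 x) \<noteq> 0"
    and "f \<in> hol_fps (polydisc \<rho>)"
    and "\<And>j. j < \<kappa> \<Longrightarrow> \<phi> j \<in> hol (polydisc \<rho>)"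
  shows "\<exists>!u. formal_solution (polydisc \<rho>) m\<^sub>0 m \<kappa> I \<Lambda> v a f \<phi> u"
proof -
  let ?U = "polydisc \<rho>"
  have nz: "\<forall>j::nat. m\<^sub>0 (of_nat j) \<noteq> 0"
    using regular_moment_function_nonzero[OF assms(3)] by blast
  define N where "N = nonlinear_part ?U m\<^sub>0 m I \<Lambda> v a"
  define G where "G = (\<lambda>u k. if k < \<kappa> then (\<lambda>x. m\<^sub>0 0 / m\<^sub>0 (of_nat k) * \<phi> k x)
      else (\<lambda>x. m\<^sub>0 (of_nat (k - \<kappa>)) / m\<^sub>0 (of_nat k) *
        (fps_nth f (k - \<kappa>) + fps_nth (N (Abs_fps u)) (k - \<kappa>)) x))"
  have inv: "Abs_fps (fps_nth u) = u" for u :: "(complex ^ 'n::_ \<Rightarrow> complex) fps"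
    by (simp add: fps_eq_iff)
  have iff: "formal_solution ?U m\<^sub>0 m \<kappa> I \<Lambda> v a f \<phi> u \<longleftrightarrow>
               (\<forall>k. fps_nth u k \<in> hol ?U) \<and> fps_nth u = G (fps_nth u)" for u
    unfolding formal_solution_iff_recursion[OF nz] G_def N_def inv by (simp add: hol_fps_def)
  have "\<exists>!w. (\<forall>k. w k \<in> hol ?U) \<and> w = G w"
  proof (rule strictly_causal_fixpoint)
    fix u w :: "nat \<Rightarrow> complex ^ 'n::_ \<Rightarrow> complex" and k
    assume agree: "\<And>i. i < k \<Longrightarrow> u i = w i"
    have "fps_nth (N (Abs_fps u)) (k - \<kappa>) = fps_nth (N (Abs_fps w)) (k - \<kappa>)" if "\<not> k < \<kappa>"
      unfolding N_def by (rule nonlinear_part_causal[OF nz assms(12)]) (use agree that in auto)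
    thus "G u k = G w k" by (simp add: G_def)
  next
    fix u :: "nat \<Rightarrow> complex ^ 'n::_ \<Rightarrow> complex" and k
    assume u: "\<And>i. u i \<in> hol ?U"
    have "fps_nth (N (Abs_fps u)) j \<in> hol ?U" for j
      unfolding N_def
    proof (rule nonlinear_part_hol[OF nz])
      show "moment_deriv_multi ?U m q g \<in> hol ?U" if "g \<in> hol ?U" for q g
        using that by (rule moment_deriv_multi_hol) (rule regular_moment_function_growth[OF assms(4)])
      show "taylor_t (a T) \<in> hol_fps ?U" if "n \<in> I" "T \<in> \<Lambda> n" for n T
        using assms(13)[OF that] assms(5) by (rule taylor_t_hol_fps)
      show "Abs_fps u \<in> hol_fps ?U" using u by (simp add: hol_fps_def)
    qed
    moreover have "fps_nth f j \<in> hol ?U" for j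
      using assms(15) by (simp add: hol_fps_def)
    ultimately show "G u k \<in> hol ?U"
      unfolding G_def by (cases "k < \<kappa>") (simp_all only: if_True if_False hol_cmult hol_add assms(16))
  qed (use hol_zero in blast)
  then obtain w where w: "\<And>k. w k \<in> hol ?U" "w = G w"
    and unique: "\<And>w'. (\<forall>k. w' k \<in> hol ?U) \<and> w' = G w' \<Longrightarrow> w' = w" by blast
  show ?thesis
  proof (rule ex1I[of _ "Abs_fps w"])
    show "formal_solution ?U m\<^sub>0 m \<kappa> I \<Lambda> v a f \<phi> (Abs_fps w)"
    proof -
      have "fps_nth (Abs_fps w) = w" by (simp add: fun_eq_iff)
      thus ?thesis using w unfolding iff by metis
    qed
    show "u = Abs_fps w" if "formal_solution ?U m\<^sub>0 m \<kappa> I \<Lambda> v a f \<phi> u" for u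
      using unique[of "fps_nth u"] that[unfolded iff] inv[of u] by simp
  qed
qed

end
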